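(* Let $s_i=2l_i\in\mathbb Z_{\ge0}$, fix signs $\pm_1,\pm_2$, and let $\mathbf R_{l_1,l_2}$ be the restriction of the universal $R$-matrix $\mathbf R$ of $U_q(\mathfrak{osp}(2|1))$ to $W_{s_1}^{\pm_1}\otimes W_{s_2}^{\pm_2}$. Then for basis vectors $e^{l_i}_{m_i,\epsilon_i},e^{l_i}_{m_i',\epsilon_i'}\in W_{s_i}^{\pm_i}$, $$\left\langle e^{l_1}_{m_1',\epsilon_1'}\otimes e^{l_2}_{m_2',\epsilon_2'},\mathbf R_{l_1,l_2}(e^{l_1}_{m_1,\epsilon_1}\otimes e^{l_2}_{m_2,\epsilon_2})\right\rangle=0$$ if $m_1'-m_1\ne m_2-m_2'$ or $m_1'-m_1=m_2-m_2'<0$. Otherwise, with $n=m_1'-m_1$, this matrix coefficient equals $$i^{(l_1-m_1+l_2+m_2-1)n-2m_1'm_2'}(-1)^{\epsilon_1\epsilon_2+n}q^{\frac12n(n-1)+2m_1'm_2'}\,\frac{(q+q^{-1})^n}{\{n\}_q!}\,\frac{\{l_1-m_1\}_q!}{\{l_1-m_1-n\}_q!}\,\frac{\{l_2+m_2\}_q!}{\{l_2+m_2-n\}_q!},$$ which is also equal to $$q_*^{\frac12n(n-1)+2m_1'm_2'}(-1)^{\epsilon_1\epsilon_2}\frac{(q_*-q_*^{-1})^n}{[n]_{q_*}!}\,\frac{[l_1-m_1]_{q_*}!}{[l_1-m_1-n]_{q_*}!}\,\frac{[l_2+m_2]_{q_*}!}{[l_2+m_2-n]_{q_*}!}.$$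
   Context: $q=e^{\pi i b^2}$, $q_*:=-iq=e^{\pi i b_*^2}$ with $b_*^2=b^2-\frac12$; $q^x=e^{\pi i b^2x}$, $q_*^x=e^{\pi i b_*^2x}$, $i^x=e^{\pi i x/2}$; $q_*$ is not a root of unity. $[n]_{p}=\frac{p^n-p^{-n}}{p-p^{-1}}$, $\{n\}_q=\frac{q^{-n}-(-1)^nq^n}{q+q^{-1}}=i^{1-n}[n]_{q_*}$, with factorials $[n]_p!=\prod_{k=1}^n[k]_p$, $\{n\}_q!=\prod_{k=1}^n\{k\}_q$; a matrix coefficient with a denominator factorial of a negative integer does not occur. For $s=2l\in\mathbb Z_{\ge0}$, $W_s$ has basis $e^l_{m,\pm}$, $m=-l,-l+1,\dots,l$, with $e^l_{m,+}$ even, $e^l_{m,-}$ odd; write $e^l_{m,\epsilon}$, $\epsilon\in\{0,1\}$, for $e^l_{m,(-1)^\epsilon}$. The quantum superalgebra $U_q(\mathfrak{osp}(2|1))$ (odd generators $\mathcal E,\mathcal F$, even $\mathcal K$; $\mathcal E\mathcal F+\mathcal F\mathcal E=\frac{\mathcal K-\mathcal K^{-1}}{q+q^{-1}}$, $\mathcal K\mathcal E=q^2\mathcal E\mathcal K$, $\mathcal K\mathcal F=q^{-2}\mathcal F\mathcal K$) acts by $\mathcal Ke^l_{m,\pm}=\pm q_*^{2m}e^l_{m,\pm}$, $\mathcal Ee^l_{m,\pm}=[l-m]_{q_*}e^l_{m+1,\mp}$, $\mathcal Fe^l_{m,\pm}=\mp i[l+m]_{q_*}e^l_{m-1,\mp}$;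 also $He^l_{m,\pm}=2m\,e^l_{m,\pm}$. $W_s=W_s^+\oplus W_s^-$, where $W_s^{\pm}$ is the submodule spanned by the vectors $e^l_{m,\pm(-1)^{l-m}}$ (so within $W_s^\pm$ the parity $\epsilon$ is determined by $m$). $\langle\cdot,\cdot\rangle$ is the bilinear pairing for which the basis vectors $e^{l_1}_{m_1,\epsilon_1}\otimes e^{l_2}_{m_2,\epsilon_2}$ are orthonormal. The universal $R$-matrix is $\mathbf R=C\,q_*^{\frac{H\otimes H}2}\sum_{n\ge0}a_n\mathcal E^n\otimes\mathcal F^n$, with $a_n=(-1)^nq^{\frac12n(n-1)}\frac{(q+q^{-1})^n}{\{n\}_q!}$ and $C(e^{l_1}_{m_1,\epsilon_1}\otimes e^{l_2}_{m_2,\epsilon_2})=(-1)^{\epsilon_1\epsilon_2}e^{l_1}_{m_1,\epsilon_1}\otimes e^{l_2}_{m_2,\epsilon_2}$. Tensor products are super: $(A\otimes B)(v\otimes w)=(-1)^{|B||v|}Av\otimes Bw$. *)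

theory Defs
  imports Complex_Main "HOL-Library.Poly_Mapping" "HOL-Library.FuncSet"
begin

section \<open>Powers of the deformation parameters and q-numbers\<close>

text \<open>Non-integral powers always refer to the fixed logarithms
  \<open>q\<^sup>x = exp (\<pi> i b\<^sup>2 x)\<close>, \<open>q\<^sub>*\<^sup>x = exp (\<pi> i (b\<^sup>2 - 1/2) x)\<close>, \<open>i\<^sup>x = exp (\<pi> i x / 2)\<close>,
  and not to the principal branch.\<close>

definition q_pow :: "complex \<Rightarrow> complex \<Rightarrow> complex" where
  "q_pow b x = exp (of_real pi * \<i> * b\<^sup>2 * x)"

definition qs_pow :: "complex \<Rightarrow> complex \<Rightarrow> complex" where
  "qs_pow b x = exp (of_real pi * \<i> * (b\<^sup>2 - 1/2) * x)"

definition i_pow :: "complex \<Rightarrow> complex" where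
  "i_pow x = exp (of_real pi * \<i> * x / 2)"

definition qq :: "complex \<Rightarrow> complex" where
  "qq b = exp (of_real pi * \<i> * b\<^sup>2)"

definition qs :: "complex \<Rightarrow> complex" where
  "qs b = - \<i> * qq b"

definition root_of_unity :: "complex \<Rightarrow> bool" where
  "root_of_unity z \<longleftrightarrow> (\<exists>n::nat. n > 0 \<and> z ^ n = 1)"

definition qnum :: "complex \<Rightarrow> int \<Rightarrow> complex" where
  "qnum p n = (p powi n - p powi (-n)) / (p - inverse p)"

definition qbrace :: "complex \<Rightarrow> int \<Rightarrow> complex" where
  "qbrace q n = (q powi (-n) - (-1) powi n * q powi n) / (q + inverse q)"

text \<open>For negative \<open>n\<close> the products below are empty; no such factorial is ever relevant.\<close>

definition qnum_fact :: "complex \<Rightarrow> int \<Rightarrow> complex" where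
  "qnum_fact p n = (\<Prod>k\<in>{1..n}. qnum p k)"

definition qbrace_fact :: "complex \<Rightarrow> int \<Rightarrow> complex" where
  "qbrace_fact q n = (\<Prod>k\<in>{1..n}. qbrace q k)"


section \<open>Free complex vector spaces with a distinguished basis\<close>

text \<open>The space with basis \<open>'a\<close> consists of the finitely supported functions on \<open>'a\<close>.  The tensor
  product of the spaces with bases \<open>'a\<close> and \<open>'b\<close> is the space with basis \<open>'a \<times> 'b\<close>.\<close>

type_synonym 'a vec = "'a \<Rightarrow>\<^sub>0 complex"

abbreviation coord :: "'a vec \<Rightarrow> 'a \<Rightarrow> complex" where
  "coord \<equiv> Poly_Mapping.lookup"

definition vscale :: "complex \<Rightarrow> 'a vec \<Rightarrow> 'a vec" where
  "vscale c v = Poly_Mapping.map ((*) c) v"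

lemma coord_vscale [simp]: "coord (vscale c v) j = c * coord v j"
  by (cases "coord v j = 0") (simp_all add: vscale_def Poly_Mapping.map.rep_eq)

global_interpretation vec: vector_space vscale
  defines vspan = vec.span
  by unfold_locales (auto intro!: poly_mapping_eqI simp: lookup_add algebra_simps)

declare vec.scale_minus_left [simp del]

definition bvec :: "'a \<Rightarrow> 'a vec" where
  "bvec j = Poly_Mapping.single j 1"

definition lin_ext :: "('a \<Rightarrow> 'b vec) \<Rightarrow> 'a vec \<Rightarrow> 'b vec" where
  "lin_ext f v = (\<Sum>j\<in>Poly_Mapping.keys v. vscale (coord v j) (f j))"

text \<open>The bilinear (not sesquilinear) pairing for which the basis is orthonormal.\<close>

definition pairing :: "'a vec \<Rightarrow> 'a vec \<Rightarrow> complex" where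
  "pairing v w = (\<Sum>j\<in>Poly_Mapping.keys v. coord v j * coord w j)"

definition vtensor :: "'a vec \<Rightarrow> 'b vec \<Rightarrow> ('a \<times> 'b) vec" (infixr "\<otimes>\<^sub>v" 70) where
  "v \<otimes>\<^sub>v w = (\<Sum>j\<in>Poly_Mapping.keys v. \<Sum>k\<in>Poly_Mapping.keys w.
      Poly_Mapping.single (j, k) (coord v j * coord w k))"

definition space_tensor :: "'a vec set \<Rightarrow> 'b vec set \<Rightarrow> ('a \<times> 'b) vec set" where
  "space_tensor V W = vspan {v \<otimes>\<^sub>v w | v w. v \<in> V \<and> w \<in> W}"


section \<open>The modules \<open>W\<^sub>s\<close> and \<open>W\<^sub>s\<^sup>\<plusminus>\<close> over \<open>U\<^sub>q(osp(2|1))\<close>\<close>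

text \<open>The index \<open>(m, \<epsilon>)\<close> stands for \<open>e\<^sup>l\<^sub>m\<^sub>,\<^sub>\<epsilon>\<close>, where \<open>\<epsilon> = False\<close> is even (the sign \<open>+\<close>) and
  \<open>\<epsilon> = True\<close> is odd (the sign \<open>-\<close>).  The modules are parametrized by \<open>l = s/2\<close>; all of them are
  subspaces of the one space with basis \<^typ>\<open>real \<times> bool\<close>.\<close>

type_synonym osp_index = "real \<times> bool"

abbreviation evec :: "real \<Rightarrow> bool \<Rightarrow> osp_index vec" where
  "evec m \<epsilon> \<equiv> bvec (m, \<epsilon>)"

definition weights :: "real \<Rightarrow> real set" where
  "weights l = {m. \<exists>k::nat. m = - l + of_nat k \<and> m \<le> l}"

definition W_index :: "real \<Rightarrow> osp_index set" where
  "W_index l = weights l \<times> UNIV"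

definition W_space :: "real \<Rightarrow> osp_index vec set" where
  "W_space l = vspan (bvec ` W_index l)"

text \<open>The vectors \<open>e\<^sup>l\<^sub>m\<^sub>,\<^sub>\<sigma>\<^sub>'\<close> with sign \<open>\<sigma>' = \<sigma> (-1)\<^sup>l\<^sup>-\<^sup>m\<close>, for \<open>\<sigma> = 1\<close> or \<open>\<sigma> = -1\<close>.\<close>

definition Wpm_index :: "real \<Rightarrow> int \<Rightarrow> osp_index set" where
  "Wpm_index l \<sigma> = {(m, \<epsilon>). m \<in> weights l \<and> (-1) ^ of_bool \<epsilon> = \<sigma> * (-1) ^ nat \<lfloor>l - m\<rfloor>}"

definition Wpm_space :: "real \<Rightarrow> int \<Rightarrow> osp_index vec set" where
  "Wpm_space l \<sigma> = vspan (bvec ` Wpm_index l \<sigma>)"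

text \<open>On \<open>W\<^sub>s\<close> the numbers \<open>l - m\<close> and \<open>l + m\<close> are integers, so the floors only convert types.  That these operators
  satisfy the defining relations of \<open>U\<^sub>q(osp(2|1))\<close> on \<open>W\<^sub>s\<close> is lemma \<open>osp_relations\<close> below.\<close>

definition osp_K :: "complex \<Rightarrow> osp_index vec \<Rightarrow> osp_index vec" where
  "osp_K b = lin_ext (\<lambda>(m, \<epsilon>).
     vscale ((-1) ^ of_bool \<epsilon> * qs_pow b (2 * of_real m)) (evec m \<epsilon>))"

definition osp_Kinv :: "complex \<Rightarrow> osp_index vec \<Rightarrow> osp_index vec" where
  "osp_Kinv b = lin_ext (\<lambda>(m, \<epsilon>).
     vscale ((-1) ^ of_bool \<epsilon> * qs_pow b (- 2 * of_real m)) (evec m \<epsilon>))"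

definition osp_E :: "complex \<Rightarrow> real \<Rightarrow> osp_index vec \<Rightarrow> osp_index vec" where
  "osp_E b l = lin_ext (\<lambda>(m, \<epsilon>). vscale (qnum (qs b) \<lfloor>l - m\<rfloor>) (evec (m + 1) (\<not> \<epsilon>)))"

definition osp_F :: "complex \<Rightarrow> real \<Rightarrow> osp_index vec \<Rightarrow> osp_index vec" where
  "osp_F b l = lin_ext (\<lambda>(m, \<epsilon>).
     vscale (- ((-1) ^ of_bool \<epsilon>) * \<i> * qnum (qs b) \<lfloor>l + m\<rfloor>) (evec (m - 1) (\<not> \<epsilon>)))"

definition osp_H :: "osp_index vec \<Rightarrow> osp_index vec" where
  "osp_H = lin_ext (\<lambda>(m, \<epsilon>). vscale (2 * of_real m) (evec m \<epsilon>))"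


section \<open>The universal R-matrix\<close>

text \<open>The super tensor product \<open>A \<otimes> B\<close> of operators, \<open>B\<close> being homogeneous of degree \<open>d\<close>.\<close>

definition op_tensor :: "nat \<Rightarrow> (osp_index vec \<Rightarrow> osp_index vec) \<Rightarrow>
    (osp_index vec \<Rightarrow> osp_index vec) \<Rightarrow>
    (osp_index \<times> osp_index) vec \<Rightarrow> (osp_index \<times> osp_index) vec" where
  "op_tensor d A B = lin_ext (\<lambda>((m1, \<epsilon>1), (m2, \<epsilon>2)).
     vscale ((-1) ^ (d * of_bool \<epsilon>1)) (A (evec m1 \<epsilon>1) \<otimes>\<^sub>v B (evec m2 \<epsilon>2)))"

text \<open>\<open>q\<^sub>*\<^sup>X\<close> for an operator \<open>X\<close> that is diagonal in the distinguished basis: a basis vector with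
  eigenvalue \<open>x\<close> is multiplied by \<open>q\<^sub>*\<^sup>x\<close>.\<close>

definition qs_pow_diag :: "complex \<Rightarrow> ('a vec \<Rightarrow> 'a vec) \<Rightarrow> 'a vec \<Rightarrow> 'a vec" where
  "qs_pow_diag b X = lin_ext (\<lambda>j. vscale (qs_pow b (coord (X (bvec j)) j)) (bvec j))"

definition op_C :: "(osp_index \<times> osp_index) vec \<Rightarrow> (osp_index \<times> osp_index) vec" where
  "op_C = lin_ext (\<lambda>((m1, \<epsilon>1), (m2, \<epsilon>2)).
     vscale ((-1) ^ (of_bool \<epsilon>1 * of_bool \<epsilon>2)) (evec m1 \<epsilon>1 \<otimes>\<^sub>v evec m2 \<epsilon>2))"

definition R_coeff :: "complex \<Rightarrow> nat \<Rightarrow> complex" where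
  "R_coeff b n = (-1) ^ n * q_pow b (of_nat n * (of_nat n - 1) / 2)
     * (qq b + inverse (qq b)) ^ n / qbrace_fact (qq b) (int n)"

text \<open>\<open>Sum_any\<close> sums all nonzero terms, of which there are only finitely many on
  \<open>W\<^sub>s \<otimes> W\<^sub>t\<close> because \<open>E\<close> is nilpotent there; see lemma \<open>finite_universal_R_support\<close>.\<close>

definition universal_R ::
    "complex \<Rightarrow> real \<Rightarrow> real \<Rightarrow> (osp_index \<times> osp_index) vec \<Rightarrow> (osp_index \<times> osp_index) vec" where
  "universal_R b l1 l2 v =
     op_C (qs_pow_diag b (\<lambda>w. vscale (1/2) (op_tensor 0 osp_H osp_H w))
       (Sum_any (\<lambda>n. vscale (R_coeff b n)
          (op_tensor n (osp_E b l1 ^^ n) (osp_F b l2 ^^ n) v))))"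

definition R_restricted ::
    "complex \<Rightarrow> real \<Rightarrow> int \<Rightarrow> real \<Rightarrow> int
      \<Rightarrow> (osp_index \<times> osp_index) vec \<Rightarrow> (osp_index \<times> osp_index) vec" where
  "R_restricted b l1 \<sigma>1 l2 \<sigma>2 =
     restrict (universal_R b l1 l2) (space_tensor (Wpm_space l1 \<sigma>1) (Wpm_space l2 \<sigma>2))"


section \<open>Basic facts\<close>

lemma qs_conv_exp: "qs b = exp (of_real pi * \<i> * (b\<^sup>2 - 1/2))"
proof -
  have "exp (of_real pi * \<i> * (b\<^sup>2 - 1/2)) = exp (of_real pi * \<i> * b\<^sup>2) * exp (- (of_real pi * \<i> / 2))"
    by (simp add: exp_add [symmetric] algebra_simps)
  also have "exp (- (of_real pi * \<i> / 2)) = inverse (exp (\<i> * of_real (pi/2)))"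
    by (simp add: exp_minus mult.commute)
  also have "exp (\<i> * of_real (pi/2)) = \<i>"
    unfolding cis_conv_exp [symmetric] by simp
  finally show ?thesis by (simp add: qs_def qq_def)
qed

lemma qs_pow_1: "qs_pow b 1 = qs b"
  by (simp add: qs_conv_exp qs_pow_def)

lemma qs_nonzero [simp]: "qs b \<noteq> 0"
  by (simp add: qs_conv_exp)

lemma qq_nonzero [simp]: "qq b \<noteq> 0"
  by (simp add: qq_def)

lemma qs_pow_of_int: "qs_pow b (of_int n) = qs b powi n"
  unfolding qs_conv_exp qs_pow_def exp_power_int by (simp add: mult.commute)

lemma qs_pow_add: "qs_pow b (x + y) = qs_pow b x * qs_pow b y"
  by (simp add: qs_pow_def exp_add [symmetric] algebra_simps add_divide_distrib)

lemma qbrace_conv_qnum: "qbrace (qq b) n = i_pow (1 - of_int n) * qnum (qs b) n"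
proof -
  have qq: "qq b = \<i> * qs b" by (simp add: qs_def)
  have ip: "i_pow (1 - of_int n) = \<i> * \<i> powi (-n)"
  proof -
    have "i_pow (1 - of_int n) = exp (of_real pi * \<i> / 2) * exp (of_real pi * \<i> / 2 * of_int (-n))"
      by (simp add: i_pow_def exp_add [symmetric] algebra_simps diff_divide_distrib)
    also have "exp (of_real pi * \<i> / 2 * of_int (-n)) = exp (of_real pi * \<i> / 2) powi (-n)"
      unfolding exp_power_int by (simp add: mult.commute)
    also have "exp (of_real pi * \<i> / 2) = \<i>"
      using cis_conv_exp [of "pi/2"] by (simp add: mult.commute)
    finally show ?thesis .
  qed
  have neg: "(-1) powi n * \<i> powi n = \<i> powi (-n)"
    by (simp add: power_int_mult_distrib [symmetric] power_int_minus power_int_inverse [symmetric])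
  have "qq b powi (-n) - (-1) powi n * qq b powi n
      = \<i> powi (-n) * (qs b powi (-n) - qs b powi n)"
    unfolding qq power_int_mult_distrib right_diff_distrib mult.assoc [symmetric] neg ..
  moreover have "qq b + inverse (qq b) = \<i> * (qs b - inverse (qs b))"
    unfolding qq by (simp add: algebra_simps)
  moreover have "\<i> powi (-n) * (x - y) / (\<i> * z) = \<i> * \<i> powi (-n) * ((y - x) / z)" for x y z
    by (cases "z = 0") (simp_all add: field_simps)
  ultimately show ?thesis
    by (simp only: qbrace_def qnum_def ip)
qed

lemma coord_bvec: "coord (bvec j) k = (if j = k then 1 else 0)"
  by (simp add: bvec_def lookup_single when_def)

lemma pairing_bvec [simp]: "pairing (bvec j) v = coord v j"
  by (simp add: pairing_def bvec_def)

lemma coord_sum: "coord (sum f A) j = (\<Sum>a\<in>A. coord (f a) j)"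
  by (induction A rule: infinite_finite_induct) (simp_all add: lookup_add)

lemma lin_ext_bvec [simp]: "lin_ext f (bvec j) = f j"
  by (simp add: lin_ext_def bvec_def)

lemma vtensor_bvec [simp]: "bvec j \<otimes>\<^sub>v bvec k = bvec (j, k)"
  by (simp add: vtensor_def bvec_def)

lemma lin_ext_superset:
  assumes "finite A" "Poly_Mapping.keys v \<subseteq> A"
  shows "lin_ext f v = (\<Sum>j\<in>A. vscale (coord v j) (f j))"
  unfolding lin_ext_def using assms
  by (intro sum.mono_neutral_left) (auto simp: in_keys_iff)

lemma lin_ext_add: "lin_ext f (v + w) = lin_ext f v + lin_ext f w"
proof -
  let ?A = "Poly_Mapping.keys v \<union> Poly_Mapping.keys w"
  have "lin_ext f (v + w) = (\<Sum>j\<in>?A. vscale (coord (v + w) j) (f j))"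
    by (intro lin_ext_superset) (auto dest: Poly_Mapping.keys_add [THEN subsetD])
  thus ?thesis
    by (simp add: lin_ext_superset [of ?A] lookup_add vec.scale_left_distrib sum.distrib)
qed

lemma lin_ext_scale: "lin_ext f (vscale c v) = vscale c (lin_ext f v)"
proof -
  have "lin_ext f (vscale c v) = (\<Sum>j\<in>Poly_Mapping.keys v. vscale (coord (vscale c v) j) (f j))"
    by (intro lin_ext_superset) (auto simp: in_keys_iff)
  thus ?thesis by (simp add: lin_ext_def vec.scale_sum_right)
qed

lemma lin_ext_0 [simp]: "lin_ext f 0 = 0"
  by (simp add: lin_ext_def)

lemma linear_lin_ext: "Vector_Spaces.linear vscale vscale (lin_ext f)"
  by unfold_locales (simp_all add: lin_ext_add lin_ext_scale)

lemma span_bvec: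
  fixes A :: "'a set"
  shows "vspan (bvec ` A) = {v. Poly_Mapping.keys v \<subseteq> A}"
proof (intro equalityI subsetI)
  have "vec.subspace {v :: 'a vec. Poly_Mapping.keys v \<subseteq> A}"
  proof (rule vec.subspaceI)
    fix x y :: "'a vec"
    assume "x \<in> {v. Poly_Mapping.keys v \<subseteq> A}" "y \<in> {v. Poly_Mapping.keys v \<subseteq> A}"
    thus "x + y \<in> {v. Poly_Mapping.keys v \<subseteq> A}"
      using Poly_Mapping.keys_add [of x y] by auto
  qed (auto simp: in_keys_iff subset_iff)
  hence "vspan (bvec ` A) \<subseteq> {v. Poly_Mapping.keys v \<subseteq> A}"
    by (intro vec.span_minimal) (auto simp: bvec_def)
  thus "v \<in> {v. Poly_Mapping.keys v \<subseteq> A}" if "v \<in> vspan (bvec ` A)" for v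
    using that by blast
next
  fix v :: "'a vec" assume v: "v \<in> {v. Poly_Mapping.keys v \<subseteq> A}"
  have "v = lin_ext bvec v"
    by (rule poly_mapping_eqI) (auto simp: lin_ext_def coord_sum coord_bvec in_keys_iff if_distrib cong: if_cong)
  also have "\<dots> \<in> vspan (bvec ` A)"
    unfolding lin_ext_def using v by (intro vec.span_sum vec.span_scale vec.span_base) auto
  finally show "v \<in> vspan (bvec ` A)" .
qed

lemma lin_ext_maps_span:
  assumes "\<And>j. j \<in> A \<Longrightarrow> f j \<in> vspan S"
  shows "lin_ext f ` vspan (bvec ` A) \<subseteq> vspan S"
  unfolding span_bvec lin_ext_def using assms
  by (auto intro!: vec.span_sum vec.span_scale)

lemma space_tensor_bvec:
  "space_tensor (vspan (bvec ` A)) (vspan (bvec ` B)) = vspan (bvec ` (A \<times> B))"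
proof
  have "v \<otimes>\<^sub>v w \<in> vspan (bvec ` (A \<times> B))"
    if "Poly_Mapping.keys v \<subseteq> A" "Poly_Mapping.keys w \<subseteq> B" for v w
  proof -
    have "Poly_Mapping.single (j, k) (coord v j * coord w k) = vscale (coord v j * coord w k) (bvec (j, k))"
      for j k by (rule poly_mapping_eqI) (simp add: coord_bvec lookup_single when_def)
    note single = this
    show ?thesis
      unfolding vtensor_def single using that
      by (intro vec.span_sum vec.span_scale vec.span_base imageI) auto
  qed
  thus "space_tensor (vspan (bvec ` A)) (vspan (bvec ` B)) \<subseteq> vspan (bvec ` (A \<times> B))"
    unfolding space_tensor_def by (intro vec.span_minimal) (auto simp: span_bvec [of A] span_bvec [of B])
  show "vspan (bvec ` (A \<times> B)) \<subseteq> space_tensor (vspan (bvec ` A)) (vspan (bvec ` B))"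
    unfolding space_tensor_def
  proof (rule vec.span_mono, safe)
    fix a b assume "a \<in> A" "b \<in> B"
    thus "\<exists>v w. bvec (a, b) = v \<otimes>\<^sub>v w \<and> v \<in> vspan (bvec ` A) \<and> w \<in> vspan (bvec ` B)"
      by (intro exI [of _ "bvec a"] exI [of _ "bvec b"]) (simp add: vec.span_base)
  qed
qed

lemma osp_ops_evec [simp]:
  "osp_K b (evec m \<epsilon>) = vscale ((-1) ^ of_bool \<epsilon> * qs_pow b (2 * of_real m)) (evec m \<epsilon>)"
  "osp_Kinv b (evec m \<epsilon>) = vscale ((-1) ^ of_bool \<epsilon> * qs_pow b (- 2 * of_real m)) (evec m \<epsilon>)"
  "osp_E b l (evec m \<epsilon>) = vscale (qnum (qs b) \<lfloor>l - m\<rfloor>) (evec (m + 1) (\<not> \<epsilon>))"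
  "osp_F b l (evec m \<epsilon>) =
     vscale (- ((-1) ^ of_bool \<epsilon>) * \<i> * qnum (qs b) \<lfloor>l + m\<rfloor>) (evec (m - 1) (\<not> \<epsilon>))"
  "osp_H (evec m \<epsilon>) = vscale (2 * of_real m) (evec m \<epsilon>)"
  by (simp_all add: osp_K_def osp_Kinv_def osp_E_def osp_F_def osp_H_def)

lemma osp_ops_linear:
  "Vector_Spaces.linear vscale vscale (osp_K b)"
  "Vector_Spaces.linear vscale vscale (osp_Kinv b)"
  "Vector_Spaces.linear vscale vscale (osp_E b l)"
  "Vector_Spaces.linear vscale vscale (osp_F b l)"
  "Vector_Spaces.linear vscale vscale osp_H"
  by (simp_all add: osp_K_def osp_Kinv_def osp_E_def osp_F_def osp_H_def linear_lin_ext)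

lemma osp_ops_scale:
  "osp_K b (vscale c v) = vscale c (osp_K b v)"
  "osp_Kinv b (vscale c v) = vscale c (osp_Kinv b v)"
  "osp_E b l (vscale c v) = vscale c (osp_E b l v)"
  "osp_F b l (vscale c v) = vscale c (osp_F b l v)"
  by (simp_all add: osp_K_def osp_Kinv_def osp_E_def osp_F_def lin_ext_scale)

lemma weights_integral:
  assumes "2 * l = of_nat s" "m \<in> weights l"
  obtains j k :: nat where "l + m = of_nat k" "l - m = of_nat j" "j + k = s"
proof -
  obtain k :: nat where k: "m = - l + of_nat k" "m \<le> l" using assms by (auto simp: weights_def)
  hence "of_nat k \<le> (of_nat s :: real)" using assms by simp
  hence "k \<le> s" by simp
  thus thesis using k assms by (intro that [of k "s - k"]) (auto simp: of_nat_diff)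
qed

lemma vtensor_0_left [simp]: "0 \<otimes>\<^sub>v w = 0"
  by (simp add: vtensor_def)

lemma coord_vtensor: "coord (v \<otimes>\<^sub>v w) (j, k) = coord v j * coord w k"
proof -
  have "coord (v \<otimes>\<^sub>v w) (j, k) =
      (\<Sum>a\<in>Poly_Mapping.keys v. \<Sum>b\<in>Poly_Mapping.keys w.
         if a = j then if b = k then coord v j * coord w k else 0 else 0)"
    unfolding vtensor_def coord_sum
    by (intro sum.cong) (auto simp: lookup_single when_def)
  also have "\<dots> = (\<Sum>a\<in>Poly_Mapping.keys v. if a = j then
      (\<Sum>b\<in>Poly_Mapping.keys w. if b = k then coord v j * coord w k else 0) else 0)"
    by (intro sum.cong) auto
  also have "\<dots> = coord v j * coord w k"
    by (auto simp: in_keys_iff)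
  finally show ?thesis .
qed

text \<open>\<open>(H \<otimes> H)/2\<close> is diagonal, as required by \<^const>\<open>qs_pow_diag\<close>.\<close>

lemma tensor_HH_half_bvec:
  "vscale (1/2) (op_tensor 0 osp_H osp_H (bvec ((m1, \<epsilon>1), (m2, \<epsilon>2))))
     = vscale (2 * of_real m1 * of_real m2) (bvec ((m1, \<epsilon>1), (m2, \<epsilon>2)))"
  by (rule poly_mapping_eqI) (auto simp: op_tensor_def coord_vtensor coord_bvec split_paired_all)

lemma qnum_identity:
  assumes "p \<noteq> 0" "p - inverse p \<noteq> 0"
  shows "qnum p i * qnum p (j + 1) - qnum p j * qnum p (i + 1) = qnum p (i - j)"
proof -
  define x y where "x = p powi i" and "y = p powi j"
  have nz: "x \<noteq> 0" "y \<noteq> 0" using assms by (auto simp: x_def y_def)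
  have "qnum p i = (x - inverse x) / (p - inverse p)" "qnum p j = (y - inverse y) / (p - inverse p)"
    "qnum p (i + 1) = (x * p - inverse (x * p)) / (p - inverse p)"
    "qnum p (j + 1) = (y * p - inverse (y * p)) / (p - inverse p)"
    "qnum p (i - j) = (x / y - y / x) / (p - inverse p)"
    using assms
    by (simp_all only: qnum_def x_def y_def power_int_minus power_int_add power_int_diff)
       (simp_all add: power_int_add power_int_diff)
  note eqs = this
  have "(x - inverse x) * (y * p - inverse (y * p)) - (y - inverse y) * (x * p - inverse (x * p))
      = (p - inverse p) * (x / y - y / x)"
    using nz assms(1) by (simp add: field_simps)
  moreover have "a / d * (b / d) - c / d * (e / d) = (a * b - c * e) / (d * d)" for a b c d e :: complex
    by (simp add: diff_divide_distrib)
  ultimately show ?thesis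
    using assms(2) unfolding eqs by simp
qed

lemma osp_relations:
  assumes "2 * l = of_nat s" "m \<in> weights l" "\<not> root_of_unity (qs b)"
  shows "osp_K b (osp_Kinv b (evec m \<epsilon>)) = evec m \<epsilon>"
    and "osp_K b (osp_E b l (evec m \<epsilon>)) = vscale ((qq b)\<^sup>2) (osp_E b l (osp_K b (evec m \<epsilon>)))"
    and "osp_K b (osp_F b l (evec m \<epsilon>)) = vscale (inverse ((qq b)\<^sup>2)) (osp_F b l (osp_K b (evec m \<epsilon>)))"
    and "osp_E b l (osp_F b l (evec m \<epsilon>)) + osp_F b l (osp_E b l (evec m \<epsilon>))
           = vscale (inverse (qq b + inverse (qq b))) (osp_K b (evec m \<epsilon>) - osp_Kinv b (evec m \<epsilon>))"
proof -
  define p where "p = qs b"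
  obtain j k :: nat where jk: "l + m = of_nat k" "l - m = of_nat j" "j + k = s"
    using assms weights_integral by blast
  have p0: "p \<noteq> 0" by (simp add: p_def)
  have p1: "p - inverse p \<noteq> 0"
  proof
    assume "p - inverse p = 0"
    hence "p ^ 2 = 1" using p0 by (simp add: field_simps power2_eq_square)
    with assms(3) show False unfolding root_of_unity_def p_def by (metis zero_less_numeral)
  qed
  have qq: "qq b = \<i> * p" by (simp add: p_def qs_def)
  have qq2: "(qq b)\<^sup>2 = - (p\<^sup>2)" by (simp add: qq power_mult_distrib)
  have two: "qs_pow b 2 = p\<^sup>2" "qs_pow b (-2) = inverse (p\<^sup>2)"
    using qs_pow_of_int [of b 2] qs_pow_of_int [of b "-2"] by (simp_all add: p_def power_int_minus)
  have up: "qs_pow b (2 + of_real m * 2) = p\<^sup>2 * qs_pow b (2 * of_real m)"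
    and down: "qs_pow b (of_real m * 2 - 2) = inverse (p\<^sup>2) * qs_pow b (2 * of_real m)"
    using qs_pow_add [of b 2 "2 * of_real m"] qs_pow_add [of b "-2" "2 * of_real m"] two
    by (simp_all add: algebra_simps)
  have inv: "qs_pow b (2 * of_real m) * qs_pow b (- (2 * of_real m)) = 1"
    using qs_pow_add [of b "2 * of_real m" "- (2 * of_real m)"] by (simp add: qs_pow_def)
  show "osp_K b (osp_Kinv b (evec m \<epsilon>)) = evec m \<epsilon>"
    using inv by (cases \<epsilon>) (simp_all add: osp_ops_scale mult.commute)
  show "osp_K b (osp_E b l (evec m \<epsilon>)) = vscale ((qq b)\<^sup>2) (osp_E b l (osp_K b (evec m \<epsilon>)))"
    by (cases \<epsilon>) (simp_all add: osp_ops_scale qq2 up algebra_simps)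
  show "osp_K b (osp_F b l (evec m \<epsilon>)) = vscale (inverse ((qq b)\<^sup>2)) (osp_F b l (osp_K b (evec m \<epsilon>)))"
    by (cases \<epsilon>) (simp_all add: osp_ops_scale qq2 down algebra_simps)
  have fl: "\<lfloor>l + m\<rfloor> = int k" "\<lfloor>l - m\<rfloor> = int j" "\<lfloor>l - (m - 1)\<rfloor> = int j + 1" "\<lfloor>l + (m + 1)\<rfloor> = int k + 1"
    using jk by (simp_all add: floor_eq_iff)
  have "of_real (2 * m) = (of_int (int k - int j) :: complex)"
  proof -
    have "2 * m = of_int (int k - int j)" using jk by simp
    thus ?thesis by (metis of_real_of_int_eq)
  qed
  hence pm: "qs_pow b (2 * of_real m) = p powi (int k - int j)"
     "qs_pow b (- (2 * of_real m)) = p powi (- (int k - int j))"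
    using qs_pow_of_int [of b "int k - int j"] qs_pow_of_int [of b "- (int k - int j)"]
    by (simp_all add: p_def)
  have id: "qnum p (int j) * qnum p (int k + 1) - qnum p (int k) * qnum p (int j + 1)
      = - (p powi (int k - int j) - p powi (- (int k - int j))) / (p - inverse p)"
    using qnum_identity [OF p0 p1, of "int j" "int k"] by (simp add: qnum_def)
  have den: "inverse (qq b + inverse (qq b)) = - \<i> / (p - inverse p)"
  proof -
    have "qq b + inverse (qq b) = \<i> * (p - inverse p)" unfolding qq by (simp add: algebra_simps)
    thus ?thesis by (simp add: divide_inverse)
  qed
  have EF: "osp_E b l (osp_F b l (evec m \<epsilon>)) =
      vscale (- ((-1) ^ of_bool \<epsilon>) * \<i> * qnum p (int k) * qnum p (int j + 1)) (evec m \<epsilon>)"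
    by (simp add: osp_ops_scale fl p_def del: diff_diff_eq2)
  have FE: "osp_F b l (osp_E b l (evec m \<epsilon>)) =
      vscale ((-1) ^ of_bool \<epsilon> * \<i> * qnum p (int j) * qnum p (int k + 1)) (evec m \<epsilon>)"
    using fl by (cases \<epsilon>) (simp_all add: osp_ops_scale p_def mult_ac)
  have "osp_E b l (osp_F b l (evec m \<epsilon>)) + osp_F b l (osp_E b l (evec m \<epsilon>)) =
      vscale ((-1) ^ of_bool \<epsilon> * \<i> * (qnum p (int j) * qnum p (int k + 1) - qnum p (int k) * qnum p (int j + 1)))
        (evec m \<epsilon>)"
    unfolding EF FE by (simp add: vec.scale_left_distrib [symmetric] algebra_simps)
  also have "\<dots> = vscale (inverse (qq b + inverse (qq b))) (osp_K b (evec m \<epsilon>) - osp_Kinv b (evec m \<epsilon>))"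
    unfolding id den pm [symmetric]
    by (rule poly_mapping_eqI, cases \<epsilon>) (simp_all add: lookup_minus diff_divide_distrib right_diff_distrib left_diff_distrib mult_ac)
  finally show "osp_E b l (osp_F b l (evec m \<epsilon>)) + osp_F b l (osp_E b l (evec m \<epsilon>))
           = vscale (inverse (qq b + inverse (qq b))) (osp_K b (evec m \<epsilon>) - osp_Kinv b (evec m \<epsilon>))" .
qed

lemma qnum_0 [simp]: "qnum p 0 = 0"
  by (simp add: qnum_def)

lemma vscale_span_cases: "(c \<noteq> 0 \<Longrightarrow> x \<in> vspan S) \<Longrightarrow> vscale c x \<in> vspan S"
  by (cases "c = 0") (auto intro: vec.span_scale vec.span_zero)

lemma weights_step:
  assumes "2 * l = of_nat s" "m \<in> weights l"
  shows "qnum (qs b) \<lfloor>l - m\<rfloor> \<noteq> 0 \<Longrightarrow>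
           m + 1 \<in> weights l \<and> (-1) ^ nat \<lfloor>l - (m + 1)\<rfloor> = (- ((-1) ^ nat \<lfloor>l - m\<rfloor>) :: int)"
    and "qnum (qs b) \<lfloor>l + m\<rfloor> \<noteq> 0 \<Longrightarrow>
           m - 1 \<in> weights l \<and> (-1) ^ nat \<lfloor>l - (m - 1)\<rfloor> = (- ((-1) ^ nat \<lfloor>l - m\<rfloor>) :: int)"
proof -
  obtain j k :: nat where jk: "l + m = of_nat k" "l - m = of_nat j" "j + k = s"
    using assms weights_integral by blast
  show "m + 1 \<in> weights l \<and> (-1) ^ nat \<lfloor>l - (m + 1)\<rfloor> = (- ((-1) ^ nat \<lfloor>l - m\<rfloor>) :: int)"
    if "qnum (qs b) \<lfloor>l - m\<rfloor> \<noteq> 0"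
  proof -
    have "j \<noteq> 0" using that jk by (intro notI) simp
    then obtain i where i: "j = Suc i" by (cases j) auto
    have 1: "m + 1 = - l + of_nat (Suc k)" "m + 1 \<le> l" "l - (m + 1) = of_nat i"
      using jk i by simp_all
    have "m + 1 \<in> weights l" unfolding weights_def using 1(1,2) by blast
    thus ?thesis unfolding 1(3) jk(2) i floor_of_nat nat_int by simp
  qed
  show "m - 1 \<in> weights l \<and> (-1) ^ nat \<lfloor>l - (m - 1)\<rfloor> = (- ((-1) ^ nat \<lfloor>l - m\<rfloor>) :: int)"
    if "qnum (qs b) \<lfloor>l + m\<rfloor> \<noteq> 0"
  proof -
    have "k \<noteq> 0" using that jk by (intro notI) simp
    then obtain i where i: "k = Suc i" by (cases k) auto
    have 1: "m - 1 = - l + of_nat i" "m - 1 \<le> l" "l - (m - 1) = of_nat (Suc j)"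
      using jk i by simp_all
    have "m - 1 \<in> weights l" unfolding weights_def using 1(1,2) by blast
    thus ?thesis unfolding 1(3) jk(2) floor_of_nat nat_int by simp
  qed
qed

lemma W_space_invariant:
  assumes "2 * l = of_nat s"
  shows "osp_K b ` W_space l \<subseteq> W_space l" "osp_E b l ` W_space l \<subseteq> W_space l"
    "osp_F b l ` W_space l \<subseteq> W_space l"
proof -
  note steps = weights_step [OF assms]
  show "osp_K b ` W_space l \<subseteq> W_space l"
    unfolding W_space_def osp_K_def
    by (intro lin_ext_maps_span) (auto intro!: vec.span_scale intro: vec.span_base)
  show "osp_E b l ` W_space l \<subseteq> W_space l"
    unfolding W_space_def osp_E_def
    by (intro lin_ext_maps_span) (auto simp: W_index_def steps intro!: vscale_span_cases intro: vec.span_base)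
  show "osp_F b l ` W_space l \<subseteq> W_space l"
    unfolding W_space_def osp_F_def
    by (intro lin_ext_maps_span) (auto simp: W_index_def steps intro!: vscale_span_cases intro: vec.span_base)
qed

lemma Wpm_space_invariant:
  assumes "2 * l = of_nat s"
  shows "osp_K b ` Wpm_space l \<sigma> \<subseteq> Wpm_space l \<sigma>" "osp_E b l ` Wpm_space l \<sigma> \<subseteq> Wpm_space l \<sigma>"
    "osp_F b l ` Wpm_space l \<sigma> \<subseteq> Wpm_space l \<sigma>"
proof -
  have flip: "(-1) ^ of_bool (\<not> \<epsilon>) = (- ((-1) ^ of_bool \<epsilon>) :: int)" for \<epsilon> by simp
  show "osp_K b ` Wpm_space l \<sigma> \<subseteq> Wpm_space l \<sigma>"
    unfolding Wpm_space_def osp_K_def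
    by (intro lin_ext_maps_span) (auto intro!: vec.span_scale intro: vec.span_base)
  have "(m + 1, \<not> \<epsilon>) \<in> Wpm_index l \<sigma>" if "(m, \<epsilon>) \<in> Wpm_index l \<sigma>" "qnum (qs b) \<lfloor>l - m\<rfloor> \<noteq> 0" for m \<epsilon>
    using that weights_step(1) [OF assms, of m b] by (simp add: Wpm_index_def flip del: of_bool_not_iff)
  thus "osp_E b l ` Wpm_space l \<sigma> \<subseteq> Wpm_space l \<sigma>"
    unfolding Wpm_space_def osp_E_def
    by (intro lin_ext_maps_span) (auto intro!: vscale_span_cases intro: vec.span_base)
  have "(m - 1, \<not> \<epsilon>) \<in> Wpm_index l \<sigma>" if "(m, \<epsilon>) \<in> Wpm_index l \<sigma>" "qnum (qs b) \<lfloor>l + m\<rfloor> \<noteq> 0" for m \<epsilon>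
    using that weights_step(2) [OF assms, of m b] by (simp add: Wpm_index_def flip del: of_bool_not_iff)
  thus "osp_F b l ` Wpm_space l \<sigma> \<subseteq> Wpm_space l \<sigma>"
    unfolding Wpm_space_def osp_F_def
    by (intro lin_ext_maps_span) (auto intro!: vscale_span_cases intro: vec.span_base)
qed

lemma osp_E_power:
  "(osp_E b l ^^ n) (evec m \<epsilon>) =
     vscale (\<Prod>i<n. qnum (qs b) \<lfloor>l - (m + of_nat i)\<rfloor>) (evec (m + of_nat n) (\<epsilon> \<noteq> odd n))"
  by (induction n) (simp_all add: osp_ops_scale mult_ac add_ac)

lemma osp_E_nilpotent:
  assumes "2 * l = of_nat s" "m \<in> weights l" "n > s"
  shows "(osp_E b l ^^ n) (evec m \<epsilon>) = 0"
proof -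
  obtain j k :: nat where jk: "l + m = of_nat k" "l - m = of_nat j" "j + k = s"
    using assms weights_integral by blast
  have "l - (m + of_nat j) = 0" "j < n" using jk assms by simp_all
  hence "(\<Prod>i<n. qnum (qs b) \<lfloor>l - (m + of_nat i)\<rfloor>) = 0"
    by (intro prod_zero) (auto intro!: bexI [of _ j])
  thus ?thesis by (simp add: osp_E_power)
qed

lemma finite_universal_R_support:
  assumes "2 * l1 = of_nat s1" "v \<in> space_tensor (W_space l1) (W_space l2)"
  shows "finite {n. vscale (R_coeff b n) (op_tensor n (osp_E b l1 ^^ n) (osp_F b l2 ^^ n) v) \<noteq> 0}"
proof (rule finite_subset)
  have v: "Poly_Mapping.keys v \<subseteq> W_index l1 \<times> W_index l2"
    using assms(2) unfolding W_space_def space_tensor_bvec by (simp add: span_bvec)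
  have "op_tensor n (osp_E b l1 ^^ n) (osp_F b l2 ^^ n) v = 0" if "n > s1" for n
    unfolding op_tensor_def lin_ext_def using v
    by (intro sum.neutral) (auto simp: W_index_def osp_E_nilpotent [OF assms(1) _ that])
  thus "{n. vscale (R_coeff b n) (op_tensor n (osp_E b l1 ^^ n) (osp_F b l2 ^^ n) v) \<noteq> 0} \<subseteq> {..s1}"
    by (auto simp: not_le [symmetric])
qed simp

end

theory Submission
  imports Defs
begin

text \<open>On a basis vector the \<open>n\<close>-th term of the universal R-matrix is a multiple of a single basis
  vector, of weights \<open>(m\<^sub>1 + n, m\<^sub>2 - n)\<close>, so a matrix coefficient only sees the term
  \<open>n = m\<^sub>1' - m\<^sub>1\<close>.  The signs and powers of \<open>i\<close> coming from \<open>C\<close>, from the super tensor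
  product and from \<open>F\<^sup>n\<close> combine to \<open>(-1) ^ (\<epsilon>\<^sub>1 \<epsilon>\<^sub>2) i ^ (n\<^sup>2)\<close>, and after \<open>q = i q\<^sub>*\<close> is substituted everywhere the
  powers of \<open>i\<close> add up to a multiple of \<open>4\<close> in either formula.\<close>

section \<open>Powers of the parameters and nonvanishing of q-numbers\<close>

lemma i_pow_add: "i_pow (x + y) = i_pow x * i_pow y"
  by (simp add: i_pow_def exp_add [symmetric] algebra_simps add_divide_distrib)

lemma i_pow_of_nat: "i_pow (of_nat n) = \<i> ^ n"
proof -
  have "exp (of_real pi * \<i> / 2) = \<i>"
    using cis_conv_exp [of "pi/2"] by (simp add: mult.commute)
  moreover have "i_pow (of_nat n) = exp (of_real pi * \<i> / 2) ^ n"
    by (simp add: i_pow_def exp_of_nat_mult [symmetric] algebra_simps)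
  ultimately show ?thesis by simp
qed

lemma i_pow_nonzero [simp]: "i_pow x \<noteq> 0"
  by (simp add: i_pow_def)

lemma i_pow_minus: "i_pow (- x) = inverse (i_pow x)"
  by (simp add: i_pow_def exp_minus)

lemma i_pow_two_of_nat: "i_pow (2 * of_nat n) = (-1) ^ n"
  using i_pow_of_nat [of "2 * n"] by (simp add: power_mult)

text \<open>A product of two consecutive integers is even. The powers of \<open>i\<close> collected
  in \<open>R_term_eq\<close> and in \<open>brace_form_eq_qnum_form\<close> have exactly this total
  exponent.\<close>

lemma i_pow_two_pronic: "i_pow (2 * (of_nat n * (of_nat n + 1))) = 1"
  using i_pow_two_of_nat [of "n * (n + 1)"] by (simp add: algebra_simps minus_one_power_iff)

text \<open>Split \<open>b^2 = (b^2 - 1/2) + 1/2\<close> in the exponent; as the logarithms are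
  fixed, this works for every complex \<open>x\<close>.\<close>

lemma q_pow_conv_qs_pow: "q_pow b x = qs_pow b x * i_pow x"
  by (simp add: q_pow_def qs_pow_def i_pow_def exp_add [symmetric] algebra_simps)

lemma qq_plus_inverse: "qq b + inverse (qq b) = \<i> * (qs b - inverse (qs b))"
proof -
  have "qq b = \<i> * qs b" by (simp add: qs_def)
  thus ?thesis by (simp add: algebra_simps)
qed

text \<open>A vanishing numerator would force \<open>p powi (2 * n) = 1\<close>.\<close>

lemma qnum_nonzero:
  assumes "\<not> root_of_unity p" "p \<noteq> 0" "n > 0"
  shows "qnum p n \<noteq> 0"
proof -
  have no_power: "p powi (2 * k) \<noteq> 1" if "k > 0" for k
  proof -
    obtain j where j: "k = int j" "j > 0" using \<open>k > 0\<close> pos_int_cases by blast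
    have "p powi (2 * k) = p ^ (2 * j)"
      using power_int_of_nat [of p "2 * j"] by (simp add: j)
    thus ?thesis
      using assms(1) \<open>j > 0\<close> unfolding root_of_unity_def by (metis nat_0_less_mult_iff zero_less_numeral)
  qed
  have "p powi k - p powi (- k) \<noteq> 0" if "k > 0" for k
  proof
    assume "p powi k - p powi (- k) = 0"
    hence "p powi k * p powi k = 1"
      using assms(2) by (simp add: power_int_minus field_simps)
    moreover have "p powi (2 * k) = p powi k * p powi k"
      unfolding mult_2 using assms(2) by (intro power_int_add) simp
    ultimately show False using no_power [OF that] by simp
  qed
  \<comment> \<open>The instance at 1 is the denominator; were it 0, the quotient would be 0 by
    convention.\<close>
  from this [OF assms(3)] this [of 1] show ?thesis
    by (simp add: qnum_def power_int_minus)
qed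

section \<open>Factorials and their quotients\<close>

lemma qnum_fact_of_nat_Suc: "qnum_fact p (int (Suc n)) = qnum p (int (Suc n)) * qnum_fact p (int n)"
proof -
  have "{1..int (Suc n)} = insert (int (Suc n)) {1..int n}" by auto
  thus ?thesis by (simp add: qnum_fact_def)
qed

lemma qbrace_fact_of_nat_Suc:
  "qbrace_fact p (int (Suc n)) = qbrace p (int (Suc n)) * qbrace_fact p (int n)"
proof -
  have "{1..int (Suc n)} = insert (int (Suc n)) {1..int n}" by auto
  thus ?thesis by (simp add: qbrace_fact_def)
qed

text \<open>The quotient telescopes. The falling product is the shape in which powers of
  \<open>osp_E\<close> and \<open>osp_F\<close> deliver their coefficients.\<close>

lemma qnum_fact_quotient:
  assumes "\<not> root_of_unity p" "p \<noteq> 0" "n \<le> L"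
  shows "qnum_fact p (int L) / qnum_fact p (int L - int n) = (\<Prod>i<n. qnum p (int L - int i))"
proof -
  have "qnum_fact p k \<noteq> 0" for k
    using qnum_nonzero [OF assms(1,2)] by (auto simp: qnum_fact_def)
  moreover have "qnum_fact p (int L) = (\<Prod>i<n. qnum p (int L - int i)) * qnum_fact p (int L - int n)"
    using assms(3)
  proof (induction n)
    case (Suc n)
    hence "int L - int n = int (Suc (L - Suc n))" "int L - int (Suc n) = int (L - Suc n)"
      by (simp_all add: of_nat_diff)
    hence "qnum_fact p (int L - int n) = qnum p (int L - int n) * qnum_fact p (int L - int (Suc n))"
      by (simp only: qnum_fact_of_nat_Suc)
    with Suc show ?case by simp
  qed simp
  ultimately show ?thesis by (simp add: field_simps)
qed

text \<open>Multiply \<open>qbrace_conv_qnum\<close> over \<open>k = 1, ..., n\<close>: the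
  exponents \<open>1 - k\<close> add up to \<open>- n (n - 1) / 2\<close>.\<close>

lemma qbrace_fact_conv_qnum_fact:
  "qbrace_fact (qq b) (int n) = i_pow (- (of_nat n * (of_nat n - 1) / 2)) * qnum_fact (qs b) (int n)"
proof (induction n)
  case 0
  show ?case by (simp add: qbrace_fact_def qnum_fact_def i_pow_def)
next
  case (Suc n)
  have "i_pow (- (of_nat (Suc n) * (of_nat (Suc n) - 1) / 2)) =
      i_pow (1 - of_int (int (Suc n))) * i_pow (- (of_nat n * (of_nat n - 1) / 2))"
    unfolding i_pow_add [symmetric] by (rule arg_cong [of _ _ i_pow]) (simp add: field_simps)
  thus ?case
    unfolding qbrace_fact_of_nat_Suc qnum_fact_of_nat_Suc Suc.IH qbrace_conv_qnum by simp
qed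

text \<open>The exponent of \<open>i\<close> is the difference of those that
  \<open>qbrace_fact_conv_qnum_fact\<close> attaches to \<open>L\<close> and to
  \<open>L - n\<close>.\<close>

lemma qbrace_fact_quotient:
  assumes "n \<le> L"
  shows "qbrace_fact (qq b) (int L) / qbrace_fact (qq b) (int L - int n) =
    i_pow (of_nat n * (of_nat n + 1) / 2 - of_nat L * of_nat n)
      * (qnum_fact (qs b) (int L) / qnum_fact (qs b) (int L - int n))"
proof -
  have L: "int L - int n = int (L - n)" using assms by (simp add: of_nat_diff)
  let ?x = "- (of_nat L * (of_nat L - 1) / 2) :: complex"
  let ?y = "- (of_nat (L - n) * (of_nat (L - n) - 1) / 2) :: complex"
  have "i_pow (of_nat n * (of_nat n + 1) / 2 - of_nat L * of_nat n) = i_pow (?x + - ?y)"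
    using assms by (intro arg_cong [of _ _ i_pow]) (simp add: of_nat_diff field_simps)
  also have "\<dots> = i_pow ?x / i_pow ?y"
    by (simp only: i_pow_add i_pow_minus divide_inverse)
  finally show ?thesis
    unfolding L qbrace_fact_conv_qnum_fact by simp
qed

section \<open>Action of the universal R-matrix on basis vectors\<close>

text \<open>Each application flips the parity, so application number \<open>k\<close>, counted from
  0, contributes the scalar \<open>- (-1)^(\<epsilon> + k) i\<close>. The signs
  \<open>(-1)^k\<close> multiply to \<open>i^(n (n - 1))\<close>, which together with
  \<open>i^n\<close> gives \<open>i^(n^2)\<close>.\<close>

lemma osp_F_power:
  "(osp_F b l ^^ n) (evec m \<epsilon>) =
     vscale ((-1) ^ n * \<i> ^ (n\<^sup>2) * (-1) ^ (n * of_bool \<epsilon>) * (\<Prod>i<n. qnum (qs b) \<lfloor>l + (m - of_nat i)\<rfloor>))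
       (evec (m - of_nat n) (\<epsilon> \<noteq> odd n))"
proof (induction n)
  case (Suc n)
  have "(Suc n)\<^sup>2 = n\<^sup>2 + (2 * n + 1)" by (simp add: power2_eq_square)
  hence i: "\<i> ^ ((Suc n)\<^sup>2) = \<i> ^ (n\<^sup>2) * ((-1) ^ n * \<i>)"
    by (simp only: power_add power_mult power2_i power_one_right)
  show ?case
    unfolding funpow.simps comp_apply Suc.IH osp_ops_scale osp_ops_evec vec.scale_scale i
    by (cases \<epsilon>; cases "even n") (simp_all add: mult_ac algebra_simps)
qed simp

lemma lin_ext_sum: "lin_ext f (sum g A) = (\<Sum>a\<in>A. lin_ext f (g a))"
  by (induction A rule: infinite_finite_induct) (simp_all add: lin_ext_add)

lemma qs_pow_diag_HH_bvec:
  "qs_pow_diag b (\<lambda>w. vscale (1/2) (op_tensor 0 osp_H osp_H w)) (bvec ((m1, \<epsilon>1), (m2, \<epsilon>2)))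
     = vscale (qs_pow b (2 * of_real m1 * of_real m2)) (bvec ((m1, \<epsilon>1), (m2, \<epsilon>2)))"
  unfolding qs_pow_diag_def lin_ext_bvec tensor_HH_half_bvec by (simp add: coord_bvec)

lemma vtensor_vscale: "vscale c v \<otimes>\<^sub>v vscale d w = vscale (c * d) (v \<otimes>\<^sub>v w)"
  by (rule poly_mapping_eqI) (auto simp: coord_vtensor split_paired_all)

text \<open>The signs are already simplified: \<open>\<epsilon>1\<close> and
  \<open>\<epsilon>2\<close> are the parities before the shift, although \<open>op_C\<close> acts
  after it. The power of \<open>qs b\<close> uses the shifted weights, because the diagonal factor
  acts after \<open>E^n\<close> and \<open>F^n\<close>.\<close>

definition R_term :: "complex \<Rightarrow> real \<Rightarrow> real \<Rightarrow> osp_index \<Rightarrow> osp_index \<Rightarrow> nat \<Rightarrow> complex" where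
  "R_term b l1 l2 = (\<lambda>(m1, \<epsilon>1) (m2, \<epsilon>2) n.
     (-1) ^ (of_bool \<epsilon>1 * of_bool \<epsilon>2) * \<i> ^ (n\<^sup>2) * R_coeff b n
       * qs_pow b (2 * of_real (m1 + of_nat n) * of_real (m2 - of_nat n))
       * (\<Prod>i<n. qnum (qs b) \<lfloor>l1 - (m1 + of_nat i)\<rfloor>) * (\<Prod>i<n. qnum (qs b) \<lfloor>l2 + (m2 - of_nat i)\<rfloor>))"

lemma universal_R_bvec:
  assumes "2 * l1 = of_nat s1" "m1 \<in> weights l1"
  shows "universal_R b l1 l2 (bvec ((m1, \<epsilon>1), (m2, \<epsilon>2))) =
    (\<Sum>n\<le>s1. vscale (R_term b l1 l2 (m1, \<epsilon>1) (m2, \<epsilon>2) n)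
       (bvec ((m1 + of_nat n, \<epsilon>1 \<noteq> odd n), (m2 - of_nat n, \<epsilon>2 \<noteq> odd n))))"
proof -
  let ?g = "\<lambda>n. vscale (R_coeff b n)
    (op_tensor n (osp_E b l1 ^^ n) (osp_F b l2 ^^ n) (bvec ((m1, \<epsilon>1), (m2, \<epsilon>2))))"
  let ?D = "qs_pow_diag b (\<lambda>w. vscale (1/2) (op_tensor 0 osp_H osp_H w))"
  \<comment> \<open>Nilpotency of \<open>osp_E\<close> truncates \<open>Sum_any\<close> to a finite
    sum, through which the linear maps can be moved.\<close>
  have "?g n = 0" if "n > s1" for n
    by (simp add: op_tensor_def osp_E_nilpotent [OF assms that])
  hence "Sum_any ?g = (\<Sum>n\<le>s1. ?g n)"
    by (intro Sum_any.expand_superset) (auto simp: not_le [symmetric])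
  hence "universal_R b l1 l2 (bvec ((m1, \<epsilon>1), (m2, \<epsilon>2))) = op_C (?D (\<Sum>n\<le>s1. ?g n))"
    by (simp add: universal_R_def)
  also have "\<dots> = (\<Sum>n\<le>s1. op_C (?D (?g n)))"
    by (simp add: qs_pow_diag_def op_C_def lin_ext_sum)
  also have "\<dots> = (\<Sum>n\<le>s1. vscale (R_term b l1 l2 (m1, \<epsilon>1) (m2, \<epsilon>2) n)
       (bvec ((m1 + of_nat n, \<epsilon>1 \<noteq> odd n), (m2 - of_nat n, \<epsilon>2 \<noteq> odd n))))"
  proof (rule sum.cong [OF refl])
    fix n
    let ?P = "(\<Prod>i<n. qnum (qs b) \<lfloor>l1 - (m1 + of_nat i)\<rfloor>)"
    let ?Q = "(\<Prod>i<n. qnum (qs b) \<lfloor>l2 + (m2 - of_nat i)\<rfloor>)"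
    let ?w = "bvec ((m1 + of_nat n, \<epsilon>1 \<noteq> odd n), (m2 - of_nat n, \<epsilon>2 \<noteq> odd n))"
    let ?c = "R_coeff b n * (-1) ^ (n * of_bool \<epsilon>1)
      * ((-1) ^ n * \<i> ^ (n\<^sup>2) * (-1) ^ (n * of_bool \<epsilon>2) * ?P * ?Q)"
    have g: "?g n = vscale ?c ?w"
      by (simp add: op_tensor_def osp_E_power osp_F_power vtensor_vscale mult_ac)
    have D: "?D (vscale c v) = vscale c (?D v)" and C: "op_C (vscale c v) = vscale c (op_C v)" for c v
      by (simp_all add: qs_pow_diag_def op_C_def lin_ext_scale)
    have "op_C ?w = vscale ((-1) ^ (of_bool (\<epsilon>1 \<noteq> odd n) * of_bool (\<epsilon>2 \<noteq> odd n))) ?w"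
      by (simp add: op_C_def)
    hence "op_C (?D (?g n)) = vscale (?c * (qs_pow b (2 * of_real (m1 + of_nat n) * of_real (m2 - of_nat n))
        * (-1) ^ (of_bool (\<epsilon>1 \<noteq> odd n) * of_bool (\<epsilon>2 \<noteq> odd n)))) ?w"
      unfolding g D C qs_pow_diag_HH_bvec by (simp only: C vec.scale_scale)
    \<comment> \<open>Modulo 2, \<open>(\<epsilon>1 + n) (\<epsilon>2 + n) + n \<epsilon>1 + n + n
      \<epsilon>2\<close> equals \<open>\<epsilon>1 \<epsilon>2\<close>, since
      \<open>n^2 + n\<close> is even.\<close>
    also have "?c * (qs_pow b (2 * of_real (m1 + of_nat n) * of_real (m2 - of_nat n))
        * (-1) ^ (of_bool (\<epsilon>1 \<noteq> odd n) * of_bool (\<epsilon>2 \<noteq> odd n))) = R_term b l1 l2 (m1, \<epsilon>1) (m2, \<epsilon>2) n"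
      unfolding R_term_def
      by (cases \<epsilon>1; cases \<epsilon>2; cases "even n") (simp_all add: mult_ac)
    finally show "op_C (?D (?g n)) = vscale (R_term b l1 l2 (m1, \<epsilon>1) (m2, \<epsilon>2) n) ?w" .
  qed
  finally show ?thesis .
qed

text \<open>The sign of a vector is \<open>\<sigma> (-1)^(l - m)\<close>, and \<open>l - m\<close>
  drops by \<open>n\<close>. Hence inside these submodules matching weights already force matching
  parities.\<close>

lemma Wpm_index_parity:
  assumes "(m, \<epsilon>) \<in> Wpm_index l \<sigma>" "(m', \<epsilon>') \<in> Wpm_index l \<sigma>" "2 * l = of_nat s"
    and "m' = m + of_nat n" "\<sigma> \<in> {1, -1}"
  shows "\<epsilon>' = (\<epsilon> \<noteq> odd n)"
proof -
  have weights: "m \<in> weights l" "m' \<in> weights l"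
    and signs: "(-1) ^ of_bool \<epsilon> = \<sigma> * (-1) ^ nat \<lfloor>l - m\<rfloor>" "(-1) ^ of_bool \<epsilon>' = \<sigma> * (-1) ^ nat \<lfloor>l - m'\<rfloor>"
    using assms(1,2) by (auto simp: Wpm_index_def)
  obtain j where j: "l - m = of_nat j" using weights_integral [OF assms(3) weights(1)] by metis
  obtain j' where j': "l - m' = of_nat j'" using weights_integral [OF assms(3) weights(2)] by metis
  have "real j = real (j' + n)" using assms(4) j j' by simp
  hence jj': "j = j' + n" by (simp only: of_nat_eq_iff)
  show ?thesis
    using signs assms(5) unfolding j j' floor_of_nat nat_int jj'
    by (cases \<epsilon>; cases \<epsilon>'; cases "even n"; cases "even j'") auto
qed

section \<open>Collecting the powers of \<open>i\<close>\<close>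

text \<open>The numerator gives \<open>i^n\<close> by \<open>qq_plus_inverse\<close>; the factorial
  in the denominator gives the rest of the exponent.\<close>

lemma brace_power_over_fact:
  "(qq b + inverse (qq b)) ^ n / qbrace_fact (qq b) (int n) =
    i_pow (of_nat n + of_nat n * (of_nat n - 1) / 2)
      * ((qs b - inverse (qs b)) ^ n / qnum_fact (qs b) (int n))"
proof -
  have "(\<i> * w) ^ n / (inverse c * d) = \<i> ^ n * c * (w ^ n / d)" if "c \<noteq> 0" for c d w :: complex
    using that by (simp add: power_mult_distrib field_simps)
  thus ?thesis
    unfolding qbrace_fact_conv_qnum_fact qq_plus_inverse i_pow_add i_pow_of_nat i_pow_minus by simp
qed

text \<open>The exponents of \<open>i\<close> are \<open>n^2\<close> from the signs,
  \<open>n (n - 1) / 2\<close> from the power of \<open>q\<close>, \<open>n + n (n - 1) / 2\<close>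
  from \<open>brace_power_over_fact\<close> and \<open>2 n\<close> from \<open>(-1)^n\<close>. Their
  sum is \<open>2 n (n + 1)\<close>.\<close>

lemma R_term_eq:
  assumes "\<not> root_of_unity (qs b)" "n \<le> L1" "n \<le> L2" "l1 - m1 = of_nat L1" "l2 + m2 = of_nat L2"
  shows "R_term b l1 l2 (m1, \<epsilon>1) (m2, \<epsilon>2) n =
    qs_pow b (of_nat n * (of_nat n - 1) / 2 + 2 * of_real ((m1 + of_nat n) * (m2 - of_nat n)))
      * (-1) ^ (of_bool \<epsilon>1 * of_bool \<epsilon>2)
      * ((qs b - inverse (qs b)) ^ n / qnum_fact (qs b) (int n))
      * (qnum_fact (qs b) (int L1) / qnum_fact (qs b) (int L1 - int n))
      * (qnum_fact (qs b) (int L2) / qnum_fact (qs b) (int L2 - int n))"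
proof -
  have "\<lfloor>l1 - (m1 + of_nat i)\<rfloor> = int L1 - int i" "\<lfloor>l2 + (m2 - of_nat i)\<rfloor> = int L2 - int i" for i
    using assms(4,5) by (simp_all add: floor_eq_iff)
  hence prods: "(\<Prod>i<n. qnum (qs b) \<lfloor>l1 - (m1 + of_nat i)\<rfloor>)
        = qnum_fact (qs b) (int L1) / qnum_fact (qs b) (int L1 - int n)"
      "(\<Prod>i<n. qnum (qs b) \<lfloor>l2 + (m2 - of_nat i)\<rfloor>)
        = qnum_fact (qs b) (int L2) / qnum_fact (qs b) (int L2 - int n)"
    using assms(1-3) by (simp_all add: qnum_fact_quotient)
  let ?N = "of_nat n :: complex"
  let ?x = "?N * (?N - 1) / 2"
  have "\<i> ^ (n\<^sup>2) * i_pow ?x * i_pow (?N + ?x) * (-1) ^ n = i_pow (of_nat (n\<^sup>2) + ?x + (?N + ?x) + 2 * ?N)"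
    by (simp only: i_pow_add i_pow_of_nat i_pow_two_of_nat)
  also have "of_nat (n\<^sup>2) + ?x + (?N + ?x) + 2 * ?N = 2 * (?N * (?N + 1))"
    by (simp add: power2_eq_square field_simps)
  also note i_pow_two_pronic
  finally have i: "\<i> ^ (n\<^sup>2) * i_pow ?x * i_pow (?N + ?x) * (-1) ^ n = 1" .
  define Z where "Z = (qs b - inverse (qs b)) ^ n / qnum_fact (qs b) (int n)"
  have "R_coeff b n = (-1) ^ n * (qs_pow b ?x * i_pow ?x) * (i_pow (?N + ?x) * Z)"
    unfolding R_coeff_def Z_def brace_power_over_fact [symmetric] q_pow_conv_qs_pow by simp
  hence "\<i> ^ (n\<^sup>2) * R_coeff b n = (\<i> ^ (n\<^sup>2) * i_pow ?x * i_pow (?N + ?x) * (-1) ^ n) * (qs_pow b ?x * Z)"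
    by (simp only: mult_ac)
  hence R: "\<i> ^ (n\<^sup>2) * R_coeff b n = qs_pow b ?x * Z"
    unfolding i by simp
  have assoc: "s * j * r * k * u * v = (j * r) * (s * k * u * v)" for s j r k u v :: complex
    by (simp only: mult_ac)
  show ?thesis
    unfolding R_term_def prod.case prods qs_pow_add Z_def [symmetric] assoc R of_real_mult
    by (simp only: mult_ac)
qed

text \<open>Here \<open>x\<close> stands for \<open>m1' * m2'\<close>. It cancels between the
  explicit power of \<open>i\<close> and the one hidden in \<open>q_pow\<close>, and
  \<open>L1\<close> and \<open>L2\<close> cancel against the factorial quotients. What remains is
  again \<open>2 n (n + 1)\<close>.\<close>

lemma brace_form_eq_qnum_form:
  fixes x :: complex
  assumes "n \<le> L1" "n \<le> L2"
  shows "i_pow ((of_nat L1 + of_nat L2 - 1) * of_nat n - 2 * x)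
      * (-1) ^ (e + n)
      * q_pow b (of_nat n * (of_nat n - 1) / 2 + 2 * x)
      * ((qq b + inverse (qq b)) ^ n / qbrace_fact (qq b) (int n))
      * (qbrace_fact (qq b) (int L1) / qbrace_fact (qq b) (int L1 - int n))
      * (qbrace_fact (qq b) (int L2) / qbrace_fact (qq b) (int L2 - int n))
    = qs_pow b (of_nat n * (of_nat n - 1) / 2 + 2 * x)
      * (-1) ^ e
      * ((qs b - inverse (qs b)) ^ n / qnum_fact (qs b) (int n))
      * (qnum_fact (qs b) (int L1) / qnum_fact (qs b) (int L1 - int n))
      * (qnum_fact (qs b) (int L2) / qnum_fact (qs b) (int L2 - int n))" (is "?lhs = ?rhs")
proof -
  let ?N = "of_nat n :: complex"
  let ?y = "?N * (?N - 1) / 2 + 2 * x"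
  let ?a = "(of_nat L1 + of_nat L2 - 1) * ?N - 2 * x"
  let ?b = "?N + ?N * (?N - 1) / 2"
  let ?c1 = "?N * (?N + 1) / 2 - of_nat L1 * ?N"
  let ?c2 = "?N * (?N + 1) / 2 - of_nat L2 * ?N"
  have "i_pow ?a * (-1) ^ n * i_pow ?y * i_pow ?b * i_pow ?c1 * i_pow ?c2
      = i_pow (?a + 2 * ?N + ?y + ?b + ?c1 + ?c2)"
    by (simp only: i_pow_add i_pow_two_of_nat)
  also have "?a + 2 * ?N + ?y + ?b + ?c1 + ?c2 = 2 * (?N * (?N + 1))"
    by (simp add: field_simps)
  also note i_pow_two_pronic
  finally have i: "i_pow ?a * (-1) ^ n * i_pow ?y * i_pow ?b * i_pow ?c1 * i_pow ?c2 = 1" .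
  have "?lhs = (i_pow ?a * (-1) ^ n * i_pow ?y * i_pow ?b * i_pow ?c1 * i_pow ?c2) * ?rhs"
    unfolding brace_power_over_fact qbrace_fact_quotient [OF assms(1)] qbrace_fact_quotient [OF assms(2)]
      q_pow_conv_qs_pow power_add
    by (simp only: mult_ac)
  thus ?thesis unfolding i by simp
qed

section \<open>Matrix coefficients on the submodules\<close>

theorem proposition2p7:
  fixes b :: complex and s1 s2 :: nat and l1 l2 :: real and \<sigma>1 \<sigma>2 :: int
    and m1 m2 m1' m2' :: real and \<epsilon>1 \<epsilon>2 \<epsilon>1' \<epsilon>2' :: bool
  defines "coeff \<equiv> pairing (evec m1' \<epsilon>1' \<otimes>\<^sub>v evec m2' \<epsilon>2')
                     (R_restricted b l1 \<sigma>1 l2 \<sigma>2 (evec m1 \<epsilon>1 \<otimes>\<^sub>v evec m2 \<epsilon>2))"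
  assumes "\<not> root_of_unity (qs b)"
    and "of_nat s1 = 2 * l1" and "of_nat s2 = 2 * l2"
    and "\<sigma>1 \<in> {1, -1}" and "\<sigma>2 \<in> {1, -1}"
    and "(m1, \<epsilon>1) \<in> Wpm_index l1 \<sigma>1" and "(m1', \<epsilon>1') \<in> Wpm_index l1 \<sigma>1"
    and "(m2, \<epsilon>2) \<in> Wpm_index l2 \<sigma>2" and "(m2', \<epsilon>2') \<in> Wpm_index l2 \<sigma>2"
  shows "(if m1' - m1 \<noteq> m2 - m2' \<or> (m1' - m1 = m2 - m2' \<and> m2 - m2' < 0) then coeff = 0
          else let n = nat \<lfloor>m1' - m1\<rfloor>; N = of_nat n; L1 = \<lfloor>l1 - m1\<rfloor>; L2 = \<lfloor>l2 + m2\<rfloor>;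
                   q = qq b; p = qs b in
            coeff = i_pow (of_real (l1 - m1 + l2 + m2 - 1) * N - 2 * of_real (m1' * m2'))
                * (-1) ^ (of_bool \<epsilon>1 * of_bool \<epsilon>2 + n)
                * q_pow b (N * (N - 1) / 2 + 2 * of_real (m1' * m2'))
                * ((q + inverse q) ^ n / qbrace_fact q (int n))
                * (qbrace_fact q L1 / qbrace_fact q (L1 - int n))
                * (qbrace_fact q L2 / qbrace_fact q (L2 - int n))
            \<and> coeff = qs_pow b (N * (N - 1) / 2 + 2 * of_real (m1' * m2'))
                * (-1) ^ (of_bool \<epsilon>1 * of_bool \<epsilon>2)
                * ((p - inverse p) ^ n / qnum_fact p (int n))
                * (qnum_fact p L1 / qnum_fact p (L1 - int n))
                * (qnum_fact p L2 / qnum_fact p (L2 - int n)))"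
proof -
  have l: "2 * l1 = of_nat s1" "2 * l2 = of_nat s2" using assms by simp_all
  have w: "m1 \<in> weights l1" "m1' \<in> weights l1" "m2 \<in> weights l2" "m2' \<in> weights l2"
    using assms by (auto simp: Wpm_index_def)
  \<comment> \<open>Outside this space \<open>restrict\<close> returns \<open>undefined\<close>, so
    membership comes first.\<close>
  have "bvec ((m1, \<epsilon>1), (m2, \<epsilon>2)) \<in> space_tensor (Wpm_space l1 \<sigma>1) (Wpm_space l2 \<sigma>2)"
    unfolding Wpm_space_def space_tensor_bvec using assms by (intro vec.span_base imageI) auto
  hence "coeff = coord (universal_R b l1 l2 (bvec ((m1, \<epsilon>1), (m2, \<epsilon>2)))) ((m1', \<epsilon>1'), (m2', \<epsilon>2'))"
    by (simp add: coeff_def R_restricted_def)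
  hence coeff: "coeff = (\<Sum>n\<le>s1. R_term b l1 l2 (m1, \<epsilon>1) (m2, \<epsilon>2) n *
      (if ((m1 + of_nat n, \<epsilon>1 \<noteq> odd n), (m2 - of_nat n, \<epsilon>2 \<noteq> odd n)) = ((m1', \<epsilon>1'), (m2', \<epsilon>2')) then 1 else 0))"
    by (simp only: universal_R_bvec [OF l(1) w(1)] coord_sum coord_vscale coord_bvec)
  show ?thesis
  proof (cases "m1' - m1 \<noteq> m2 - m2' \<or> (m1' - m1 = m2 - m2' \<and> m2 - m2' < 0)")
    case True
    \<comment> \<open>A nonzero summand would make both weight differences equal to the same natural
      number.\<close>
    hence "coeff = 0"
      unfolding coeff by (intro sum.neutral) auto
    with True show ?thesis by simp
  next
    case False
    obtain L1 where L1: "l1 - m1 = of_nat L1" "L1 \<le> s1"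
      using weights_integral [OF l(1) w(1)] by (metis le_add1)
    obtain L1' where L1': "l1 - m1' = of_nat L1'"
      using weights_integral [OF l(1) w(2)] by metis
    obtain L2 where L2: "l2 + m2 = of_nat L2"
      using weights_integral [OF l(2) w(3)] by metis
    obtain L2' where L2': "l2 + m2' = of_nat L2'"
      using weights_integral [OF l(2) w(4)] by metis
    have "real L1' \<le> real L1" using False L1 L1' by linarith
    hence "L1' \<le> L1" by simp
    \<comment> \<open>As \<open>L1' \<le> L1\<close>, the truncated subtraction is exact and
      \<open>n\<close> is the common weight difference.\<close>
    define n where "n = L1 - L1'"
    have d: "m1' = m1 + of_nat n" "m2' = m2 - of_nat n"
      using False \<open>L1' \<le> L1\<close> L1 L1' by (simp_all add: n_def of_nat_diff)
    have "real L2 = real (L2' + n)" using d L2 L2' by simp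
    \<comment> \<open>The first two bounds keep the arguments of the denominator factorials
      nonnegative; the third places \<open>n\<close> in the range of the sum.\<close>
    hence n: "n \<le> L1" "n \<le> L2" "n \<le> s1"
      using L1(2) by (simp_all only: of_nat_eq_iff) (simp_all add: n_def)
    \<comment> \<open>In the second factor the weight decreases, so the parity lemma is applied with
      the primed and unprimed indices exchanged.\<close>
    have \<epsilon>: "\<epsilon>1' = (\<epsilon>1 \<noteq> odd n)" "\<epsilon>2' = (\<epsilon>2 \<noteq> odd n)"
      using Wpm_index_parity [OF assms(7,8) l(1) d(1) assms(5)]
        Wpm_index_parity [OF assms(10,9) l(2) _ assms(6), of n] d(2) by auto
    have "coeff = (\<Sum>k\<le>s1. if k = n then R_term b l1 l2 (m1, \<epsilon>1) (m2, \<epsilon>2) k else 0)"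
      unfolding coeff by (intro sum.cong refl) (auto simp: d \<epsilon>)
    hence coeff': "coeff = R_term b l1 l2 (m1, \<epsilon>1) (m2, \<epsilon>2) n"
      using n by simp
    have conv: "nat \<lfloor>m1' - m1\<rfloor> = n" "\<lfloor>l1 - m1\<rfloor> = int L1" "\<lfloor>l2 + m2\<rfloor> = int L2"
      "of_real (l1 - m1 + l2 + m2 - 1) = (of_nat L1 + of_nat L2 - 1 :: complex)"
    proof -
      show "nat \<lfloor>m1' - m1\<rfloor> = n" by (simp add: d)
      show "\<lfloor>l1 - m1\<rfloor> = int L1" "\<lfloor>l2 + m2\<rfloor> = int L2" by (simp_all only: L1 L2 floor_of_nat)
      have "l1 - m1 + l2 + m2 - 1 = of_nat L1 + of_nat L2 - 1" using L1 L2 by linarith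
      thus "of_real (l1 - m1 + l2 + m2 - 1) = (of_nat L1 + of_nat L2 - 1 :: complex)"
        by (metis of_real_1 of_real_add of_real_diff of_real_of_nat_eq)
    qed
    note eq = coeff' [unfolded R_term_eq [OF assms(2) n(1,2) L1(1) L2], folded d]
    \<comment> \<open>Rewriting the brace formula into the q-number formula reduces both conjuncts
      to \<open>eq\<close>.\<close>
    show ?thesis
      unfolding if_not_P [OF False] Let_def conv brace_form_eq_qnum_form [OF n(1,2)]
      using eq by simp
  qed
qed

end
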